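(* Let $f,g,h$ be twice continuously differentiable and let $(x^*,y^* )$ be an S-stationary point of the reformulation (R) satisfying CC-SOSC. Then $(x^*,y^* )$ is a strict local minimum with respect to $x$ of (R).
   Context: Setting. $f:\mathbb{R}^n\to\mathbb{R}$, $g:\mathbb{R}^n\to\mathbb{R}^m$, $h:\mathbb{R}^n\to\mathbb{R}^p$ are continuously differentiable, $\kappa<n$ is an integer, $X=\{x\in\mathbb{R}^n\mid g(x)\le 0,\ h(x)=0\}$, $\|x\|_0$ is the number of nonzero components of $x$, and $\{x\in X\mid \|x\|_0\le\kappa\}\neq\emptyset$. The reformulation (R) is: minimize $f(x)$ over $(x,y)\in\mathbb{R}^n\times\mathbb{R}^n$ subject to $g(x)\le0$, $h(x)=0$, $0\le y\le e$, $e^Ty\ge n-\kappa$, $x\circ y=0$, where $e$ is the all-ones vector and $\circ$ is the componentwise product. $Z$ denotes the feasible set of (R). $e_i$ denotes the $i$-th unit vector and $B_r(\cdot)$ an open ball of radius $r$ with respect to an arbitrary norm. Index sets for $(x^*,y^* )\in Z$: $I_g=\{i\mid g_i(x^* )=0\}$, $I_{\pm0}=\{i\mid x_i^*\ne0,\ y_i^*=0\}$, $I_{00}=\{i\mid x_i^*=0,\ y_i^*=0\}$, $I_{0+}=\{i\mid x_i^*=0,\ y_i^*\in(0,1)\}$, $I_{01}=\{i\mid x_i^*=0,\ y_i^*=1\}$. S-stationarity: $(x^*,y^* )\in Z$ is S-stationary if there is an S-stationary multiplier $(\lambda^*,\mu^*,\gamma^* )\in\mathbb{R}^m\times\mathbb{R}^p\times\mathbb{R}^n$,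 i.e. one with $\nabla f(x^* )+\sum_{i=1}^m\lambda_i^*\nabla g_i(x^* )+\sum_{i=1}^p\mu_i^*\nabla h_i(x^* )+\sum_{i=1}^n\gamma_i^*e_i=0$, $\lambda_i^*\ge0$ and $\lambda_i^*g_i(x^* )=0$ for all $i=1,\dots,m$, and $\gamma_i^*=0$ for all $i\in I_{\pm0}\cup I_{00}$. CC-linearisation cone: $\mathcal{L}^{CC}_Z(x^*,y^* )$ is the set of all $(d_x,d_y)\in\mathbb{R}^n\times\mathbb{R}^n$ with $\nabla g_i(x^* )^Td_x\le0$ for $i\in I_g$; $\nabla h_i(x^* )^Td_x=0$ for $i=1,\dots,p$; $e^Td_y\ge0$ if $e^Ty^*=n-\kappa$; $e_i^Td_y=0$ for $i\in I_{\pm0}$; $e_i^Td_y\ge0$ for $i\in I_{00}$; $e_i^Td_y\le0$ for $i\in I_{01}$; $e_i^Td_x=0$ for $i\in I_{01}\cup I_{0+}$; $(e_i^Td_x)(e_i^Td_y)=0$ for $i\in I_{00}$. CC-critical cone: $\mathcal{C}^{CC}_Z(x^*,y^* )=\{(d_x,d_y)\in\mathcal{L}^{CC}_Z(x^*,y^* )\mid\nabla f(x^* )^Td_x\le0\}$. CC-SOSC holds at an S-stationary point $(x^*,y^* )$ if for every $(d_x,d_y)\in\mathcal{C}^{CC}_Z(x^*,y^* )$ with $d_x\ne0$ there exists at least one S-stationary multiplier $(\lambda^*,\mu^*,\gamma^* )$ of $(x^*,y^* )$ (possibly depending on the direction) such that $d_x^T\left(\nabla^2f(x^* )+\sum_{i=1}^m\lambda_i^*\nabla^2g_i(x^*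 )+\sum_{i=1}^p\mu_i^*\nabla^2h_i(x^* )\right)d_x>0$. A point $(x^*,y^* )\in Z$ is a strict local minimum with respect to $x$ of (R) if there is $r>0$ such that $f(x^* )<f(x)$ for all $(x,y)\in B_r(x^*,y^* )\cap Z$ with $x\ne x^*$. *)

theory Defs
  imports "HOL-Analysis.Analysis"
begin

definition gradient :: "(real^'n \<Rightarrow> real) \<Rightarrow> real^'n \<Rightarrow> real^'n" where
  "gradient f x = (THE D. GDERIV f x :> D)"

definition hessian :: "(real^'n \<Rightarrow> real) \<Rightarrow> real^'n \<Rightarrow> real^'n^'n" where
  "hessian f x = jacobian (gradient f) (at x)"

definition twice_continuously_differentiable :: "(real^'n \<Rightarrow> real) \<Rightarrow> bool" where
  "twice_continuously_differentiable f \<longleftrightarrow>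
     (\<forall>x. f differentiable (at x)) \<and>
     (\<forall>x. gradient f differentiable (at x)) \<and>
     continuous_on UNIV (hessian f)"

lemma GDERIV_gradient:
  fixes f :: "real^'n \<Rightarrow> real"
  assumes "f differentiable (at x)"
  shows "GDERIV f x :> gradient f x"
proof -
  obtain f' where f': "(f has_derivative f') (at x)"
    using assms by (auto simp: differentiable_def)
  have lin: "linear f'"
    using f' by (rule has_derivative_linear)
  have "f' = (\<lambda>h. h \<bullet> adjoint f' 1)"
    using adjoint_works[OF lin, of _ 1] by (simp add: fun_eq_iff)
  then have ex: "GDERIV f x :> adjoint f' 1"
    unfolding gderiv_def using f' by metis
  have "D = E" if "GDERIV f x :> D" "GDERIV f x :> E" for D E
  proof -
    have "(\<lambda>h. h \<bullet> D) = (\<lambda>h. h \<bullet> E)"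
      using that unfolding gderiv_def by (rule has_derivative_unique)
    then show ?thesis
      by (metis vector_eq_ldot)
  qed
  with ex show ?thesis
    unfolding gradient_def by (metis (mono_tags, lifting) theI)
qed

text \<open>The constraint maps into \<open>\<real>\<^sup>m\<close> and \<open>\<real>\<^sup>p\<close> are families of component functions,
  \<open>g i\<close> for \<open>i < m\<close> and \<open>h i\<close> for \<open>i < p\<close>, so that \<open>m = 0\<close> and \<open>p = 0\<close> are allowed.
  Values at larger indices are irrelevant, also for the multipliers \<open>lam\<close> and \<open>mu\<close>.\<close>

definition feasible_X ::
  "nat \<Rightarrow> (nat \<Rightarrow> real^'n \<Rightarrow> real) \<Rightarrow> nat \<Rightarrow> (nat \<Rightarrow> real^'n \<Rightarrow> real) \<Rightarrow> (real^'n) set" where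
  "feasible_X m g p h = {x. (\<forall>i<m. g i x \<le> 0) \<and> (\<forall>i<p. h i x = 0)}"

definition norm0 :: "real^'n \<Rightarrow> nat" where
  "norm0 x = card {i. x $ i \<noteq> 0}"

definition feasible_Z ::
  "nat \<Rightarrow> (nat \<Rightarrow> real^'n \<Rightarrow> real) \<Rightarrow> nat \<Rightarrow> (nat \<Rightarrow> real^'n \<Rightarrow> real) \<Rightarrow> int \<Rightarrow>
   ((real^'n) \<times> (real^'n)) set" where
  "feasible_Z m g p h \<kappa> =
     {(x, y). (\<forall>i<m. g i x \<le> 0) \<and> (\<forall>i<p. h i x = 0) \<and>
              (\<forall>i. 0 \<le> y $ i \<and> y $ i \<le> 1) \<and>
              (\<Sum>i\<in>UNIV. y $ i) \<ge> real CARD('n) - real_of_int \<kappa> \<and>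
              (\<forall>i. x $ i * y $ i = 0)}"

definition I_g :: "nat \<Rightarrow> (nat \<Rightarrow> real^'n \<Rightarrow> real) \<Rightarrow> real^'n \<Rightarrow> nat set" where
  "I_g m g x = {i. i < m \<and> g i x = 0}"

definition I_pm0 :: "real^'n \<Rightarrow> real^'n \<Rightarrow> 'n set" where
  "I_pm0 x y = {i. x $ i \<noteq> 0 \<and> y $ i = 0}"

definition I_00 :: "real^'n \<Rightarrow> real^'n \<Rightarrow> 'n set" where
  "I_00 x y = {i. x $ i = 0 \<and> y $ i = 0}"

definition I_0plus :: "real^'n \<Rightarrow> real^'n \<Rightarrow> 'n set" where
  "I_0plus x y = {i. x $ i = 0 \<and> 0 < y $ i \<and> y $ i < 1}"

definition I_01 :: "real^'n \<Rightarrow> real^'n \<Rightarrow> 'n set" where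
  "I_01 x y = {i. x $ i = 0 \<and> y $ i = 1}"

definition S_multiplier ::
  "(real^'n \<Rightarrow> real) \<Rightarrow> nat \<Rightarrow> (nat \<Rightarrow> real^'n \<Rightarrow> real) \<Rightarrow> nat \<Rightarrow> (nat \<Rightarrow> real^'n \<Rightarrow> real) \<Rightarrow>
   real^'n \<Rightarrow> real^'n \<Rightarrow> (nat \<Rightarrow> real) \<Rightarrow> (nat \<Rightarrow> real) \<Rightarrow> real^'n \<Rightarrow> bool" where
  "S_multiplier f m g p h x y lam mu gam \<longleftrightarrow>
     gradient f x + (\<Sum>i<m. lam i *\<^sub>R gradient (g i) x) + (\<Sum>i<p. mu i *\<^sub>R gradient (h i) x)
       + (\<Sum>i\<in>UNIV. gam $ i *\<^sub>R axis i 1) = 0 \<and>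
     (\<forall>i<m. lam i \<ge> 0 \<and> lam i * g i x = 0) \<and>
     (\<forall>i \<in> I_pm0 x y \<union> I_00 x y. gam $ i = 0)"

definition S_stationary ::
  "(real^'n \<Rightarrow> real) \<Rightarrow> nat \<Rightarrow> (nat \<Rightarrow> real^'n \<Rightarrow> real) \<Rightarrow> nat \<Rightarrow> (nat \<Rightarrow> real^'n \<Rightarrow> real) \<Rightarrow> int \<Rightarrow>
   real^'n \<Rightarrow> real^'n \<Rightarrow> bool" where
  "S_stationary f m g p h \<kappa> x y \<longleftrightarrow>
     (x, y) \<in> feasible_Z m g p h \<kappa> \<and> (\<exists>lam mu gam. S_multiplier f m g p h x y lam mu gam)"

definition CC_linearisation_cone ::
  "nat \<Rightarrow> (nat \<Rightarrow> real^'n \<Rightarrow> real) \<Rightarrow> nat \<Rightarrow> (nat \<Rightarrow> real^'n \<Rightarrow> real) \<Rightarrow> int \<Rightarrow>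
   real^'n \<Rightarrow> real^'n \<Rightarrow> ((real^'n) \<times> (real^'n)) set" where
  "CC_linearisation_cone m g p h \<kappa> x y =
     {(dx, dy).
        (\<forall>i \<in> I_g m g x. gradient (g i) x \<bullet> dx \<le> 0) \<and>
        (\<forall>i<p. gradient (h i) x \<bullet> dx = 0) \<and>
        ((\<Sum>i\<in>UNIV. y $ i) = real CARD('n) - real_of_int \<kappa> \<longrightarrow> (\<Sum>i\<in>UNIV. dy $ i) \<ge> 0) \<and>
        (\<forall>i \<in> I_pm0 x y. dy $ i = 0) \<and>
        (\<forall>i \<in> I_00 x y. dy $ i \<ge> 0) \<and>
        (\<forall>i \<in> I_01 x y. dy $ i \<le> 0) \<and>
        (\<forall>i \<in> I_01 x y \<union> I_0plus x y. dx $ i = 0) \<and>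
        (\<forall>i \<in> I_00 x y. dx $ i * dy $ i = 0)}"

definition CC_critical_cone ::
  "(real^'n \<Rightarrow> real) \<Rightarrow> nat \<Rightarrow> (nat \<Rightarrow> real^'n \<Rightarrow> real) \<Rightarrow> nat \<Rightarrow> (nat \<Rightarrow> real^'n \<Rightarrow> real) \<Rightarrow> int \<Rightarrow>
   real^'n \<Rightarrow> real^'n \<Rightarrow> ((real^'n) \<times> (real^'n)) set" where
  "CC_critical_cone f m g p h \<kappa> x y =
     {(dx, dy). (dx, dy) \<in> CC_linearisation_cone m g p h \<kappa> x y \<and> gradient f x \<bullet> dx \<le> 0}"

definition CC_SOSC ::
  "(real^'n \<Rightarrow> real) \<Rightarrow> nat \<Rightarrow> (nat \<Rightarrow> real^'n \<Rightarrow> real) \<Rightarrow> nat \<Rightarrow> (nat \<Rightarrow> real^'n \<Rightarrow> real) \<Rightarrow> int \<Rightarrow>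
   real^'n \<Rightarrow> real^'n \<Rightarrow> bool" where
  "CC_SOSC f m g p h \<kappa> x y \<longleftrightarrow>
     (\<forall>(dx, dy) \<in> CC_critical_cone f m g p h \<kappa> x y. dx \<noteq> 0 \<longrightarrow>
        (\<exists>lam mu gam. S_multiplier f m g p h x y lam mu gam \<and>
           dx \<bullet> ((hessian f x + (\<Sum>i<m. lam i *\<^sub>R hessian (g i) x)
                  + (\<Sum>i<p. mu i *\<^sub>R hessian (h i) x)) *v dx) > 0))"

text \<open>Balls are taken with respect to an arbitrary norm on the \<open>(x, y)\<close>-space, not only
  the Euclidean one of the product type.\<close>

definition is_norm :: "('a::real_vector \<Rightarrow> real) \<Rightarrow> bool" where
  "is_norm N \<longleftrightarrow>
     (\<forall>z. N z \<ge> 0) \<and> (\<forall>z. N z = 0 \<longleftrightarrow> z = 0) \<and>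
     (\<forall>c z. N (c *\<^sub>R z) = \<bar>c\<bar> * N z) \<and>
     (\<forall>z w. N (z + w) \<le> N z + N w)"

definition norm_ball :: "('a::real_vector \<Rightarrow> real) \<Rightarrow> real \<Rightarrow> 'a \<Rightarrow> 'a set" where
  "norm_ball N r c = {z. N (z - c) < r}"

definition strict_local_min_wrt_x ::
  "((real^'n) \<times> (real^'n) \<Rightarrow> real) \<Rightarrow>
   (real^'n \<Rightarrow> real) \<Rightarrow> nat \<Rightarrow> (nat \<Rightarrow> real^'n \<Rightarrow> real) \<Rightarrow> nat \<Rightarrow> (nat \<Rightarrow> real^'n \<Rightarrow> real) \<Rightarrow> int \<Rightarrow>
   real^'n \<Rightarrow> real^'n \<Rightarrow> bool" where
  "strict_local_min_wrt_x N f m g p h \<kappa> xs ys \<longleftrightarrow>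
     (xs, ys) \<in> feasible_Z m g p h \<kappa> \<and>
     (\<exists>r>0. \<forall>(x, y) \<in> norm_ball N r (xs, ys) \<inter> feasible_Z m g p h \<kappa>. x \<noteq> xs \<longrightarrow> f xs < f x)"

end

theory Submission
  imports Defs
begin

text \<open>
  The argument is the classical one for second-order sufficiency. If the claim fails, points
  \<open>(X k, Y k)\<close> of \<open>Z\<close> with \<open>X k \<noteq> xs\<close> and \<open>f (X k) \<le> f xs\<close> converge to \<open>(xs, ys)\<close>, and by
  compactness the unit vectors \<open>sgn (X k - xs)\<close> may be assumed to converge to some \<open>d \<noteq> 0\<close>.
  Two facts make the \<open>y\<close>-variables harmless. Close to \<open>(xs, ys)\<close>, an index with \<open>ys $ i > 0\<close>
  still has \<open>y $ i > 0\<close>, so complementarity forces \<open>x $ i = 0\<close> there; and the critical cone only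
  has to be tested at \<open>(d, 0)\<close>, since all its conditions on the \<open>y\<close>-part hold for \<open>0\<close>.

  First-order expansion along \<open>X\<close> (\<open>directional_decrease\<close>) shows that \<open>(d, 0)\<close> is critical, and
  CC-SOSC supplies a multiplier for it. The corresponding Lagrangian, including the linear term
  \<open>gam \<bullet> x\<close>, has vanishing gradient at \<open>xs\<close> and satisfies \<open>L (X k) \<le> L xs\<close>: the term
  \<open>gam \<bullet> x\<close> vanishes along the sequence because \<open>gam $ i\<close> can be nonzero only where \<open>ys $ i > 0\<close>.
  Second-order expansion (\<open>directional_curvature_nonpos\<close>) then makes the quadratic form of the
  Hessian of \<open>L\<close> nonpositive at \<open>d\<close>, which contradicts CC-SOSC.
\<close>

section \<open>Balls of an arbitrary norm\<close>

text \<open>One half of the equivalence of norms in finite dimension, used to shrink a ball of \<open>N\<close>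
  into a given neighbourhood. A norm is Lipschitz, being bounded on a basis, hence
  attains a positive minimum on the Euclidean unit sphere.\<close>

lemma is_norm_lower_bound:
  fixes N :: "'a::euclidean_space \<Rightarrow> real"
  assumes "is_norm N"
  obtains c where "c > 0" "\<And>z. c * norm z \<le> N z"
proof -
  have nonneg: "N z \<ge> 0" and zero: "N z = 0 \<longleftrightarrow> z = 0"
    and scale: "N (t *\<^sub>R z) = \<bar>t\<bar> * N z" and tri: "N (z + w) \<le> N z + N w" for z w t
    using assms unfolding is_norm_def by blast+
  have sum_le: "N (sum u B) \<le> (\<Sum>b\<in>B. N (u b))" if "finite B" for u and B :: "'a set"
    using that
  proof (induction B rule: finite_induct)
    case empty
    then show ?case using zero[of 0] by simp
  next
    case (insert b B)
    then show ?case using tri[of "u b" "sum u B"] by simp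
  qed
  define C where "C = (\<Sum>b\<in>Basis. N (b::'a))"
  have upper: "N z \<le> C * norm z" for z
  proof -
    have "N z = N (\<Sum>b\<in>Basis. (z \<bullet> b) *\<^sub>R b)"
      by (simp add: euclidean_representation)
    also have "\<dots> \<le> (\<Sum>b\<in>Basis. \<bar>z \<bullet> b\<bar> * N b)"
      using sum_le[OF finite_Basis, of "\<lambda>b. (z \<bullet> b) *\<^sub>R b"] by (simp add: scale)
    also have "\<dots> \<le> (\<Sum>b\<in>Basis. norm z * N b)"
      by (intro sum_mono mult_right_mono Basis_le_norm nonneg)
    finally show ?thesis
      by (simp add: C_def sum_distrib_left mult.commute)
  qed
  have "N z - N w \<le> C * norm (z - w)" for z w
    using tri[of "z - w" w] upper[of "z - w"] by simp
  then have "\<bar>N z - N w\<bar> \<le> C * dist z w" for z w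
    by (smt (verit) dist_norm norm_minus_commute)
  moreover have "C \<ge> 0"
    unfolding C_def by (intro sum_nonneg nonneg)
  ultimately have "C-lipschitz_on UNIV N"
    by (intro lipschitz_onI) (auto simp: dist_real_def)
  then have cont: "continuous_on (sphere 0 1) N"
    by (metis lipschitz_on_continuous_on continuous_on_subset subset_UNIV)
  obtain b :: 'a where "b \<in> Basis"
    using nonempty_Basis by blast
  then have "b \<in> sphere 0 1"
    by simp
  then have "sphere (0::'a) 1 \<noteq> {}"
    by blast
  then obtain z0 where z0: "norm z0 = 1" "\<And>z. norm z = 1 \<Longrightarrow> N z0 \<le> N z"
    using continuous_attains_inf[OF compact_sphere _ cont] by auto
  show thesis
  proof
    have "z0 \<noteq> 0"
      using z0(1) by auto
    then show "N z0 > 0"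
      using nonneg[of z0] zero[of z0] by linarith
    fix z
    show "N z0 * norm z \<le> N z"
    proof (cases "z = 0")
      case False
      then have "N z0 * norm z \<le> N (sgn z) * norm z"
        by (intro mult_right_mono z0(2)) (auto simp: norm_sgn)
      also have "\<dots> = N z"
        using False by (simp add: sgn_div_norm scale)
      finally show ?thesis .
    qed (use nonneg in simp)
  qed
qed

lemma norm_ball_subset_open:
  fixes N :: "'a::euclidean_space \<Rightarrow> real"
  assumes "is_norm N" "open U" "z \<in> U"
  obtains r where "r > 0" "norm_ball N r z \<subseteq> U"
proof -
  obtain c where c: "c > 0" "\<And>w. c * norm w \<le> N w"
    using is_norm_lower_bound[OF assms(1)] by blast
  obtain e where e: "e > 0" "ball z e \<subseteq> U"
    using assms(2,3) open_contains_ball by blast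
  have "norm_ball N (c * e) z \<subseteq> ball z e"
  proof
    fix w
    assume "w \<in> norm_ball N (c * e) z"
    then have "c * norm (w - z) < c * e"
      using c(2)[of "w - z"] by (simp add: norm_ball_def)
    then show "w \<in> ball z e"
      using c(1) by (simp add: dist_norm norm_minus_commute)
  qed
  with c(1) e show thesis
    by (intro that[of "c * e"]) auto
qed

section \<open>Expansions along a convergent sequence of directions\<close>

definition approaches_along :: "(nat \<Rightarrow> 'a::real_normed_vector) \<Rightarrow> 'a \<Rightarrow> 'a \<Rightarrow> bool" where
  "approaches_along X a d \<longleftrightarrow>
     X \<longlonglongrightarrow> a \<and> (\<forall>k. X k \<noteq> a) \<and> (\<lambda>k. sgn (X k - a)) \<longlonglongrightarrow> d"

lemma approaches_along_subseq:
  fixes X :: "nat \<Rightarrow> 'a::euclidean_space"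
  assumes "X \<longlonglongrightarrow> a" "\<And>k. X k \<noteq> a"
  obtains \<sigma> d where "strict_mono \<sigma>" "approaches_along (X \<circ> \<sigma>) a d" "d \<noteq> 0"
proof -
  have "\<forall>k. sgn (X k - a) \<in> sphere 0 1"
    using assms(2) by (simp add: norm_sgn)
  then obtain d \<sigma> where d: "d \<in> sphere 0 1" "strict_mono \<sigma>"
    "((\<lambda>k. sgn (X k - a)) \<circ> \<sigma>) \<longlonglongrightarrow> d"
    using compact_sphere[of "0::'a" 1] unfolding compact_def by meson
  show thesis
  proof
    show "strict_mono \<sigma>" by fact
    show "approaches_along (X \<circ> \<sigma>) a d"
      using d LIMSEQ_subseq_LIMSEQ[OF assms(1)] assms(2)
      by (simp add: approaches_along_def o_def)
    show "d \<noteq> 0" using d(1) by auto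
  qed
qed

text \<open>This one expansion is used for a function, giving first-order information, and for its
  gradient, giving second-order information.\<close>

lemma difference_quotient_tendsto:
  assumes F: "(F has_derivative F') (at a)" and X: "approaches_along X a d"
  shows "(\<lambda>k. (F (X k) - F a) /\<^sub>R norm (X k - a)) \<longlonglongrightarrow> F' d"
proof -
  have lin: "bounded_linear F'"
    using F by (rule has_derivative_bounded_linear)
  have "filterlim X (at a) sequentially"
    using X by (simp add: approaches_along_def filterlim_at)
  moreover have "((\<lambda>x. (F x - F a - F' (x - a)) /\<^sub>R norm (x - a)) \<longlongrightarrow> 0) (at a)"
    using F by (simp add: has_derivative_at_within)
  ultimately have rem: "(\<lambda>k. (F (X k) - F a - F' (X k - a)) /\<^sub>R norm (X k - a)) \<longlonglongrightarrow> 0"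
    by (rule filterlim_compose[rotated])
  have main: "(\<lambda>k. F' (sgn (X k - a))) \<longlonglongrightarrow> F' d"
    using X bounded_linear.tendsto[OF lin] by (auto simp: approaches_along_def)
  have "(F (X k) - F a - F' (X k - a)) /\<^sub>R norm (X k - a) + F' (sgn (X k - a))
      = (F (X k) - F a) /\<^sub>R norm (X k - a)" for k
    unfolding sgn_div_norm linear_scale[OF bounded_linear.linear[OF lin]]
    by (simp flip: scaleR_add_right)
  with tendsto_add[OF rem main] show ?thesis
    by simp
qed

lemma directional_decrease:
  fixes F :: "'a::real_inner \<Rightarrow> real"
  assumes "GDERIV F a :> D" "approaches_along X a d" "\<And>k. F (X k) \<le> F a"
  shows "D \<bullet> d \<le> 0"
proof -
  have "(\<lambda>k. (F (X k) - F a) /\<^sub>R norm (X k - a)) \<longlonglongrightarrow> d \<bullet> D"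
    using difference_quotient_tendsto[OF assms(1)[unfolded gderiv_def] assms(2)] .
  then show ?thesis
    using assms(3)
    by (auto simp: inner_commute divide_simps mult_nonneg_nonpos intro!: LIMSEQ_le_const2)
qed

lemma gradient_mean_value:
  fixes F :: "'a::real_inner \<Rightarrow> real"
  assumes "\<And>x. GDERIV F x :> G x"
  obtains s where "0 < s" "s < 1" "F (a + v) - F a = G (a + s *\<^sub>R v) \<bullet> v"
proof -
  have "((\<lambda>t. F (a + t *\<^sub>R v)) has_real_derivative G (a + t *\<^sub>R v) \<bullet> v) (at t)" for t
  proof -
    have "((\<lambda>t. a + t *\<^sub>R v) has_derivative (\<lambda>\<tau>. \<tau> *\<^sub>R v)) (at t)"
      by (auto intro!: derivative_eq_intros)
    from has_derivative_compose[OF this assms[unfolded gderiv_def]]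
    show ?thesis
      by (simp add: has_field_derivative_def inner_commute mult.commute[of _ "_ \<bullet> _"])
  qed
  from MVT2[OF zero_less_one this] obtain s where "0 < s" "s < 1"
    "F (a + 1 *\<^sub>R v) - F (a + 0 *\<^sub>R v) = (1 - 0) * (G (a + s *\<^sub>R v) \<bullet> v)"
    by blast
  then show thesis
    using that by simp
qed

text \<open>By the mean value theorem, nonincrease of \<open>F\<close> from \<open>a\<close> to \<open>X k\<close> shows up as
  \<open>G (W k) \<bullet> (X k - a) \<le> 0\<close> at an intermediate point \<open>W k\<close>. As \<open>W k\<close> lies in the same direction
  from \<open>a\<close> as \<open>X k\<close> does, expanding \<open>G\<close> along \<open>W\<close> yields \<open>G' d\<close>.\<close>

lemma directional_curvature_nonpos:
  fixes F :: "'a::real_inner \<Rightarrow> real"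
  assumes F: "\<And>x. GDERIV F x :> G x" and G: "(G has_derivative G') (at a)" and crit: "G a = 0"
    and X: "approaches_along X a d" and le: "\<And>k. F (X k) \<le> F a"
  shows "d \<bullet> G' d \<le> 0"
proof -
  have "\<exists>s. 0 < s \<and> s < 1 \<and> F (X k) - F a = G (a + s *\<^sub>R (X k - a)) \<bullet> (X k - a)" for k
    using gradient_mean_value[OF F, of a "X k - a"] by auto
  then obtain s where s: "\<And>k. 0 < s k" "\<And>k. s k < 1"
    "\<And>k. F (X k) - F a = G (a + s k *\<^sub>R (X k - a)) \<bullet> (X k - a)"
    by metis
  define W where "W k = a + s k *\<^sub>R (X k - a)" for k
  have dirX: "(\<lambda>k. sgn (X k - a)) \<longlonglongrightarrow> d"
    using X by (simp add: approaches_along_def)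
  have "W \<longlonglongrightarrow> a"
  proof -
    have "(\<lambda>k. norm (X k - a)) \<longlonglongrightarrow> 0"
      using X unfolding approaches_along_def by (metis LIM_zero tendsto_norm_zero)
    moreover have "\<forall>\<^sub>F k in sequentially. norm (W k - a) \<le> norm (X k - a)"
      using s(1,2) by (simp add: W_def mult_left_le_one_le less_imp_le)
    ultimately have "(\<lambda>k. W k - a) \<longlonglongrightarrow> 0"
      by (rule Lim_null_comparison[rotated])
    then show ?thesis
      by (rule LIM_zero_cancel)
  qed
  moreover have "W k \<noteq> a" for k
    using X s(1)[of k] by (simp add: W_def approaches_along_def)
  moreover have "sgn (W k - a) = sgn (X k - a)" for k
    using s(1)[of k] by (simp add: W_def sgn_scaleR)
  ultimately have "approaches_along W a d"
    using dirX by (simp add: approaches_along_def)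
  from tendsto_inner[OF dirX difference_quotient_tendsto[OF G this]]
  have "(\<lambda>k. sgn (X k - a) \<bullet> (G (W k) /\<^sub>R norm (W k - a))) \<longlonglongrightarrow> d \<bullet> G' d"
    by (simp add: crit)
  moreover have "sgn (X k - a) \<bullet> (G (W k) /\<^sub>R norm (W k - a)) \<le> 0" for k
  proof -
    have "G (W k) \<bullet> (X k - a) \<le> 0"
      using s(3)[of k] le[of k] by (simp add: W_def)
    then have "inverse (norm (X k - a)) * inverse (norm (W k - a)) * (G (W k) \<bullet> (X k - a)) \<le> 0"
      by (intro mult_nonneg_nonpos) auto
    then show ?thesis
      by (simp add: sgn_div_norm inner_commute mult_ac)
  qed
  ultimately show ?thesis
    by (auto intro: LIMSEQ_le_const2)
qed

section \<open>The Lagrangian\<close>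

lemma twice_continuously_differentiableD:
  assumes "twice_continuously_differentiable f"
  shows "GDERIV f x :> gradient f x"
    and "(gradient f has_derivative (\<lambda>v. hessian f x *v v)) (at x)"
  using assms GDERIV_gradient[of f x] jacobian_works[of "gradient f" "at x"]
  unfolding twice_continuously_differentiable_def hessian_def by blast+

lemma sum_matrix_vector_mult:
  fixes A :: "'b \<Rightarrow> real^'n^'m"
  shows "(\<Sum>i\<in>S. A i) *v x = (\<Sum>i\<in>S. A i *v x)"
  by (induction S rule: infinite_finite_induct)
    (auto simp: matrix_vector_mult_add_rdistrib)

context
  fixes f :: "real^'n \<Rightarrow> real" and g h :: "nat \<Rightarrow> real^'n \<Rightarrow> real" and m p :: nat
    and lam mu :: "nat \<Rightarrow> real" and gam :: "real^'n"
begin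

definition lagrangian :: "real^'n \<Rightarrow> real" where
  "lagrangian x = f x + (\<Sum>i<m. lam i * g i x) + (\<Sum>i<p. mu i * h i x) + gam \<bullet> x"

definition lagrangian_gradient :: "real^'n \<Rightarrow> real^'n" where
  "lagrangian_gradient x = gradient f x + (\<Sum>i<m. lam i *\<^sub>R gradient (g i) x)
     + (\<Sum>i<p. mu i *\<^sub>R gradient (h i) x) + gam"

definition lagrangian_hessian :: "real^'n \<Rightarrow> real^'n^'n" where
  "lagrangian_hessian x = hessian f x + (\<Sum>i<m. lam i *\<^sub>R hessian (g i) x)
     + (\<Sum>i<p. mu i *\<^sub>R hessian (h i) x)"

context
  assumes f: "twice_continuously_differentiable f"
    and g: "\<forall>i<m. twice_continuously_differentiable (g i)"
    and h: "\<forall>i<p. twice_continuously_differentiable (h i)"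
begin

lemma GDERIV_lagrangian: "GDERIV lagrangian x :> lagrangian_gradient x"
proof -
  have D: "(f has_derivative (\<lambda>v. v \<bullet> gradient f x)) (at x)"
    "\<And>i. i < m \<Longrightarrow> (g i has_derivative (\<lambda>v. v \<bullet> gradient (g i) x)) (at x)"
    "\<And>i. i < p \<Longrightarrow> (h i has_derivative (\<lambda>v. v \<bullet> gradient (h i) x)) (at x)"
    using f g h twice_continuously_differentiableD(1) by (auto simp: gderiv_def)
  have "((\<lambda>x. f x + (\<Sum>i<m. lam i * g i x) + (\<Sum>i<p. mu i * h i x) + gam \<bullet> x)
      has_derivative (\<lambda>v. v \<bullet> gradient f x + (\<Sum>i<m. lam i * (v \<bullet> gradient (g i) x))
        + (\<Sum>i<p. mu i * (v \<bullet> gradient (h i) x)) + gam \<bullet> v)) (at x)"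
    by (intro has_derivative_add has_derivative_sum has_derivative_mult_right
        has_derivative_inner_right has_derivative_ident D) auto
  then show ?thesis
    unfolding gderiv_def lagrangian_def[abs_def] lagrangian_gradient_def
    by (simp add: inner_add_right inner_sum_right inner_commute)
qed

lemma lagrangian_gradient_has_derivative:
  "(lagrangian_gradient has_derivative (\<lambda>v. lagrangian_hessian x *v v)) (at x)"
proof -
  have D: "(gradient f has_derivative (\<lambda>v. hessian f x *v v)) (at x)"
    "\<And>i. i < m \<Longrightarrow> (gradient (g i) has_derivative (\<lambda>v. hessian (g i) x *v v)) (at x)"
    "\<And>i. i < p \<Longrightarrow> (gradient (h i) has_derivative (\<lambda>v. hessian (h i) x *v v)) (at x)"
    using f g h twice_continuously_differentiableD(2) by auto
  have "(lagrangian_gradient has_derivative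
      (\<lambda>v. hessian f x *v v + (\<Sum>i<m. lam i *\<^sub>R (hessian (g i) x *v v))
        + (\<Sum>i<p. mu i *\<^sub>R (hessian (h i) x *v v)) + 0)) (at x)"
    unfolding lagrangian_gradient_def[abs_def]
    by (intro has_derivative_add has_derivative_sum has_derivative_scaleR_right
        has_derivative_const D) auto
  then show ?thesis
    by (simp add: lagrangian_hessian_def matrix_vector_mult_add_rdistrib
        sum_matrix_vector_mult scaleR_matrix_vector_assoc)
qed

end

end

section \<open>Second-order sufficiency\<close>

lemma feasible_Z_D:
  assumes "(x, y) \<in> feasible_Z m g p h \<kappa>"
  shows "i < m \<Longrightarrow> g i x \<le> 0" "i < p \<Longrightarrow> h i x = 0" "x $ j * y $ j = 0" "0 \<le> y $ j"
  using assms by (auto simp: feasible_Z_def)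

text \<open>Failure of strict minimality would produce such an \<open>X\<close>. Complementarity of the points
  \<open>(X k, Y k)\<close> close to \<open>(xs, ys)\<close> is recorded as \<open>X k $ i = 0\<close> on \<open>{i. ys $ i > 0}\<close>, which passes
  to the limit direction.\<close>

lemma critical_direction:
  assumes Z: "(xs, ys) \<in> feasible_Z m g p h \<kappa>"
    and f: "twice_continuously_differentiable f"
    and g: "\<forall>i<m. twice_continuously_differentiable (g i)"
    and h: "\<forall>i<p. twice_continuously_differentiable (h i)"
    and X: "approaches_along X xs d"
    and fX: "\<And>k. f (X k) \<le> f xs"
    and gX: "\<And>k i. i < m \<Longrightarrow> g i (X k) \<le> 0" and hX: "\<And>k i. i < p \<Longrightarrow> h i (X k) = 0"
    and suppX: "\<And>k i. ys $ i > 0 \<Longrightarrow> X k $ i = 0"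
  shows "(d, 0) \<in> CC_critical_cone f m g p h \<kappa> xs ys"
proof -
  note deriv = twice_continuously_differentiableD(1)
  have "gradient f xs \<bullet> d \<le> 0"
    using directional_decrease[OF deriv[OF f] X fX] .
  moreover have "gradient (g i) xs \<bullet> d \<le> 0" if "i \<in> I_g m g xs" for i
    using that g gX by (intro directional_decrease[OF deriv X]) (auto simp: I_g_def)
  moreover have "gradient (h i) xs \<bullet> d = 0" if "i < p" for i
  proof (rule antisym)
    have D: "GDERIV (h i) xs :> gradient (h i) xs"
      using h that deriv by blast
    have eq: "h i (X k) = h i xs" for k
      using hX feasible_Z_D(2)[OF Z] that by simp
    \<comment> \<open>As \<open>h i\<close> is constant along \<open>X\<close>, both \<open>h i\<close> and \<open>- h i\<close> are nonincreasing.\<close>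
    show "gradient (h i) xs \<bullet> d \<le> 0"
      using directional_decrease[OF D X] eq by simp
    have "- gradient (h i) xs \<bullet> d \<le> 0"
      using directional_decrease[OF GDERIV_minus[OF D] X] eq by simp
    then show "0 \<le> gradient (h i) xs \<bullet> d"
      by simp
  qed
  moreover have "d $ i = 0" if "i \<in> I_01 xs ys \<union> I_0plus xs ys" for i
  proof -
    have "sgn (X k - xs) $ i = 0" for k
      using that suppX[of i k] by (auto simp: I_01_def I_0plus_def sgn_div_norm)
    moreover have "(\<lambda>k. sgn (X k - xs) $ i) \<longlonglongrightarrow> d $ i"
      using X by (intro tendsto_vec_nth) (simp add: approaches_along_def)
    ultimately show ?thesis
      by (simp add: LIMSEQ_const_iff)
  qed
  ultimately show ?thesis
    by (simp add: CC_critical_cone_def CC_linearisation_cone_def)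
qed

text \<open>Each term of the Lagrangian beyond \<open>f\<close> vanishes at \<open>xs\<close> and is nonpositive at \<open>x\<close>: for
  \<open>lam\<close> by sign and complementary slackness, for \<open>gam\<close> because where it is nonzero, \<open>ys $ i > 0\<close>
  and both points have a zero component.\<close>

lemma lagrangian_le:
  assumes Z: "(xs, ys) \<in> feasible_Z m g p h \<kappa>"
    and mult: "S_multiplier f m g p h xs ys lam mu gam"
    and fx: "f x \<le> f xs" and gx: "\<And>i. i < m \<Longrightarrow> g i x \<le> 0" and hx: "\<And>i. i < p \<Longrightarrow> h i x = 0"
    and supp: "\<And>i. ys $ i > 0 \<Longrightarrow> x $ i = 0"
  shows "lagrangian f g h m p lam mu gam x \<le> lagrangian f g h m p lam mu gam xs"
proof -
  have lam: "\<And>i. i < m \<Longrightarrow> lam i \<ge> 0 \<and> lam i * g i xs = 0"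
    and gam: "\<And>i. i \<in> I_pm0 xs ys \<union> I_00 xs ys \<Longrightarrow> gam $ i = 0"
    using mult by (auto simp: S_multiplier_def)
  have "(\<Sum>i<m. lam i * g i x) \<le> (\<Sum>i<m. lam i * g i xs)"
  proof (rule sum_mono)
    fix i
    assume "i \<in> {..<m}"
    then show "lam i * g i x \<le> lam i * g i xs"
      using lam[of i] gx[of i] by (metis lessThan_iff mult_nonneg_nonpos)
  qed
  moreover have "(\<Sum>i<p. mu i * h i x) = (\<Sum>i<p. mu i * h i xs)"
    using hx feasible_Z_D(2)[OF Z] by simp
  moreover have "gam $ i * x $ i = gam $ i * xs $ i" for i
  proof (cases "ys $ i = 0")
    case True
    then have "gam $ i = 0"
      using gam by (auto simp: I_pm0_def I_00_def)
    then show ?thesis by simp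
  next
    case False
    then have "ys $ i > 0" "xs $ i = 0"
      using feasible_Z_D(3,4)[OF Z, of i] by auto
    then show ?thesis
      using supp by simp
  qed
  then have "gam \<bullet> x = gam \<bullet> xs"
    unfolding inner_vec_def inner_real_def by presburger
  ultimately show ?thesis
    using fx by (simp add: lagrangian_def)
qed

theorem theorem3p9:
  fixes f :: "real^'n \<Rightarrow> real"
    and g h :: "nat \<Rightarrow> real^'n \<Rightarrow> real"
    and m p :: nat and \<kappa> :: int
    and xs ys :: "real^'n"
    and N :: "(real^'n) \<times> (real^'n) \<Rightarrow> real"
  assumes "\<kappa> < int CARD('n)"
    and "{x \<in> feasible_X m g p h. int (norm0 x) \<le> \<kappa>} \<noteq> {}"
    and "is_norm N"
    and "twice_continuously_differentiable f"
    and "\<forall>i<m. twice_continuously_differentiable (g i)"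
    and "\<forall>i<p. twice_continuously_differentiable (h i)"
    and "S_stationary f m g p h \<kappa> xs ys"
    and "CC_SOSC f m g p h \<kappa> xs ys"
  shows "strict_local_min_wrt_x N f m g p h \<kappa> xs ys"
proof (rule ccontr)
  note f = assms(4) and g = assms(5) and h = assms(6)
  assume not_min: "\<not> ?thesis"
  have Z: "(xs, ys) \<in> feasible_Z m g p h \<kappa>"
    using assms(7) by (simp add: S_stationary_def)
  \<comment> \<open>The open set of \<open>y\<close> that are positive wherever \<open>ys\<close> is; it turns complementarity into a
    support condition on \<open>x\<close>.\<close>
  define V where "V = (\<Inter>i\<in>{i. ys $ i > 0}. {y::real^'n. y $ i > 0})"
  have "open V"
    unfolding V_def
    by (intro open_INT) (auto intro!: open_Collect_less continuous_intros)
  have "\<exists>x. x \<noteq> xs \<and> f x \<le> f xs \<and> dist x xs < inverse (real (Suc k)) \<and>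
      (\<forall>i<m. g i x \<le> 0) \<and> (\<forall>i<p. h i x = 0) \<and> (\<forall>i. ys $ i > 0 \<longrightarrow> x $ i = 0)" for k
  proof -
    have "open (ball xs (inverse (real (Suc k))) \<times> V)"
      using \<open>open V\<close> by (intro open_Times) auto
    moreover have "(xs, ys) \<in> ball xs (inverse (real (Suc k))) \<times> V"
      by (simp add: V_def)
    ultimately obtain r where r: "r > 0"
      "norm_ball N r (xs, ys) \<subseteq> ball xs (inverse (real (Suc k))) \<times> V"
      using norm_ball_subset_open[OF assms(3)] by blast
    obtain x y where xy: "(x, y) \<in> norm_ball N r (xs, ys)" "(x, y) \<in> feasible_Z m g p h \<kappa>"
      "x \<noteq> xs" "f x \<le> f xs"
      using not_min Z r(1) unfolding strict_local_min_wrt_x_def by fastforce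
    have "dist x xs < inverse (real (Suc k))" and y: "y \<in> V"
      using xy(1) r(2) by (auto simp: dist_commute)
    moreover have "x $ i = 0" if "ys $ i > 0" for i
    proof -
      have "y $ i > 0"
        using y that by (simp add: V_def)
      then show ?thesis
        using feasible_Z_D(3)[OF xy(2), of i] by simp
    qed
    ultimately show ?thesis
      using xy feasible_Z_D[OF xy(2)] by blast
  qed
  then obtain X where X: "\<And>k. X k \<noteq> xs" "\<And>k. f (X k) \<le> f xs"
    "\<And>k. dist (X k) xs < inverse (real (Suc k))" "\<And>k i. i < m \<Longrightarrow> g i (X k) \<le> 0"
    "\<And>k i. i < p \<Longrightarrow> h i (X k) = 0" "\<And>k i. ys $ i > 0 \<Longrightarrow> X k $ i = 0"
    by metis
  have "(\<lambda>k. dist (X k) xs) \<longlonglongrightarrow> 0"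
    by (rule Lim_null_comparison[OF _ LIMSEQ_inverse_real_of_nat])
      (use X(3) in \<open>auto intro!: always_eventually less_imp_le\<close>)
  then have "X \<longlonglongrightarrow> xs"
    using tendsto_dist_iff by blast
  then obtain \<sigma> d where along: "approaches_along (X \<circ> \<sigma>) xs d" and "d \<noteq> 0"
    using approaches_along_subseq X(1) by metis
  have "(d, 0) \<in> CC_critical_cone f m g p h \<kappa> xs ys"
    using X(2,4,5,6) by (intro critical_direction[OF Z f g h along]) auto
  then obtain lam mu gam where mult: "S_multiplier f m g p h xs ys lam mu gam"
    and pos: "d \<bullet> (lagrangian_hessian f g h m p lam mu xs *v d) > 0"
    using assms(8) \<open>d \<noteq> 0\<close> unfolding CC_SOSC_def lagrangian_hessian_def by fast
  have "(\<Sum>i\<in>UNIV. gam $ i *\<^sub>R axis i 1) = gam"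
    using basis_expansion[of gam] by (simp add: scalar_mult_eq_scaleR)
  then have "lagrangian_gradient f g h m p lam mu gam xs = 0"
    using mult by (simp add: S_multiplier_def lagrangian_gradient_def)
  moreover have "lagrangian f g h m p lam mu gam ((X \<circ> \<sigma>) k)
      \<le> lagrangian f g h m p lam mu gam xs" for k
    using X(2,4,5,6) by (intro lagrangian_le[OF Z mult]) auto
  ultimately have "d \<bullet> (lagrangian_hessian f g h m p lam mu xs *v d) \<le> 0"
    by (rule directional_curvature_nonpos[OF GDERIV_lagrangian[OF f g h]
          lagrangian_gradient_has_derivative[OF f g h] _ along])
  with pos show False
    by simp
qed

end
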